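(* For every integer $r\ge 1$ there is a finite group $G$ such that $d(G)=2$ but $d_I(G)\ge r$.
   Context: For a finite group $G$, $d(G)$ is the minimal size of a generating set of $G$. Write $s^g=g^{-1}sg$. A subset $S\subseteq G$ invariably generates $G$ if $G=\langle s^{g(s)}\mid s\in S\rangle$ for every choice of elements $g(s)\in G$, $s\in S$. Define $d_I(G)=\min\{|S| : S\subseteq G \text{ invariably generates } G\}$. *)

theory Defs
  imports "HOL-Algebra.Algebra"
begin

definition generates :: "('a, 'b) monoid_scheme \<Rightarrow> 'a set \<Rightarrow> bool" where
  "generates G S \<longleftrightarrow> S \<subseteq> carrier G \<and> generate G S = carrier G"

definition conjugate_by :: "('a, 'b) monoid_scheme \<Rightarrow> 'a \<Rightarrow> 'a \<Rightarrow> 'a" where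
  "conjugate_by G s g = inv\<^bsub>G\<^esub> g \<otimes>\<^bsub>G\<^esub> s \<otimes>\<^bsub>G\<^esub> g"

definition invariably_generates :: "('a, 'b) monoid_scheme \<Rightarrow> 'a set \<Rightarrow> bool" where
  "invariably_generates G S \<longleftrightarrow> S \<subseteq> carrier G \<and>
     (\<forall>g \<in> S \<rightarrow> carrier G. generate G ((\<lambda>s. conjugate_by G s (g s)) ` S) = carrier G)"

(* Both minima are meant for finite groups, where they are attained: the whole carrier
   generates, and also invariably generates, since the conjugates of a proper subgroup of
   a finite group do not cover the group. The finiteness condition on S is
   automatic there; it rules out infinite S, for which card S = 0. *)

definition min_gen :: "('a, 'b) monoid_scheme \<Rightarrow> nat" where
  "min_gen G = (LEAST n. \<exists>S. finite S \<and> generates G S \<and> card S = n)"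

definition min_inv_gen :: "('a, 'b) monoid_scheme \<Rightarrow> nat" where
  "min_inv_gen G = (LEAST n. \<exists>S. finite S \<and> invariably_generates G S \<and> card S = n)"

end

theory Submission
  imports Defs
begin

text \<open>The group \<open>G\<close> lives in a power \<open>T\<^sup>I\<close> of the symmetric group \<open>T\<close> on \<open>n = 3m + 2\<close> points, where
  \<open>I\<close> is the set of permutations \<open>p\<close> of \<open>{3..n}\<close> with \<open>p\<^sup>3 = id\<close>. It is generated by the constant tuple
  on the cycle \<open>(2 3 \<dots> n)\<close> and the tuple \<open>((1 2) \<circ> p)\<close> over \<open>p \<in> I\<close>. The cube of the second tuple is
  the constant tuple on \<open>(1 2)\<close>, so \<open>G\<close> contains the diagonal and the tuple \<open>(p)\<close> over \<open>p \<in> I\<close>. As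
  the entries of the latter are distinct, commutators then produce every even permutation in any
  single coordinate.

  Permutations of \<open>n\<close> points fall into at most \<open>2 ^ (n + 1)\<close> classes under conjugation by even
  permutations. If \<open>S\<close> has fewer than \<open>r\<close> elements, then, since \<open>|I| \<ge> m!\<close> outgrows \<open>2 ^ ((n + 1) r)\<close>,
  some two coordinates of each \<open>s \<in> S\<close> are conjugate in this way, with the same pair of coordinates
  for all \<open>s\<close>. Conjugating in one of these coordinates only makes the two agree, and all of \<open>S\<close>
  lands in a proper subgroup.\<close>

section \<open>Covering a finite group by conjugates of a subgroup\<close>

text \<open>Counting with coset representatives: the conjugates of \<open>H\<close> contain at most
  \<open>[G : H] (|H| - 1)\<close> elements other than \<open>\<one>\<close>.\<close>

lemma (in group) conjugates_cover_imp_eq_carrier: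
  assumes fin: "finite (carrier G)" and H: "subgroup H G"
    and cover: "\<And>x. x \<in> carrier G \<Longrightarrow> \<exists>g\<in>carrier G. inv g \<otimes> x \<otimes> g \<in> H"
  shows "H = carrier G"
proof -
  have Hsub: "H \<subseteq> carrier G"
    using H by (rule subgroup.subset)
  have finH: "finite H"
    using Hsub fin by (rule finite_subset)
  define rep where "rep R = (SOME x. x \<in> R)" for R :: "'a set"
  have rep: "rep (H #> g) \<in> H #> g" if "g \<in> carrier G" for g
    unfolding rep_def using rcos_self[OF that H] by (rule someI)
  have finR: "finite (rcosets H)"
    using fin rcosets_subset_PowG[OF H] by (meson finite_Pow_iff finite_subset)
  \<comment> \<open>Conjugators in the same right coset of \<open>H\<close> differ by a conjugation
    inside \<open>H\<close>, so one representative per coset reaches every conjugate.\<close>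
  define f where "f = (\<lambda>(R, h). inv (rep R) \<otimes> h \<otimes> rep R)"
  have "carrier G - {\<one>} \<subseteq> f ` ((rcosets H) \<times> (H - {\<one>}))"
  proof
    fix x assume x: "x \<in> carrier G - {\<one>}"
    then obtain g where g: "g \<in> carrier G" "inv g \<otimes> x \<otimes> g \<in> H"
      using cover by blast
    let ?R = "H #> inv g"
    obtain k where k: "k \<in> H" "rep ?R = k \<otimes> inv g"
      using rep[of "inv g"] g by (auto simp: r_coset_def)
    have kc: "k \<in> carrier G"
      using k Hsub by blast
    let ?h = "k \<otimes> (inv g \<otimes> x \<otimes> g) \<otimes> inv k"
    have "?h \<in> H"
      using g k H by (meson subgroup.m_closed subgroup.m_inv_closed)
    have cancel: "inv a \<otimes> (a \<otimes> b) = b" "a \<otimes> (inv a \<otimes> b) = b"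
      if "a \<in> carrier G" "b \<in> carrier G" for a b
      using that by (simp_all add: m_assoc[symmetric])
    have eq: "f (?R, ?h) = x"
      using x g(1) kc by (simp add: f_def k(2) m_assoc inv_mult_group cancel)
    have "?h \<noteq> \<one>"
    proof
      assume "?h = \<one>"
      with eq have "x = inv (rep ?R) \<otimes> \<one> \<otimes> rep ?R"
        by (simp add: f_def)
      then show False
        using x kc g(1) by (simp add: k(2))
    qed
    with \<open>?h \<in> H\<close> have "(?R, ?h) \<in> (rcosets H) \<times> (H - {\<one>})"
      using g(1) Hsub by (auto intro: rcosetsI)
    with eq show "x \<in> f ` ((rcosets H) \<times> (H - {\<one>}))"
      by (metis image_eqI)
  qed
  then have "card (carrier G - {\<one>}) \<le> card ((rcosets H) \<times> (H - {\<one>}))"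
    using finR finH by (meson card_image_le card_mono finite_Diff finite_SigmaI finite_imageI le_trans)
  then have le: "order G - 1 \<le> card (rcosets H) * (card H - 1)"
    using finH H by (simp add: order_def card_cartesian_product card_Diff_singleton subgroup.one_closed)
  have lag: "card (rcosets H) * card H = order G"
    using H by (rule lagrange)
  have pos: "card H \<ge> 1" "order G \<ge> 1"
    using finH fin subgroup.one_closed[OF H] by (auto simp: order_def Suc_le_eq card_gt_0_iff)
  obtain k where k: "card H = Suc k"
    using pos(1) by (cases "card H") simp_all
  \<comment> \<open>With index i and \<open>card H = k + 1\<close>, the relations i + i k = |G| and
    |G| - 1 \<le> i k force i \<le> 1.\<close>
  have "card (rcosets H) + card (rcosets H) * k = order G" "order G - 1 \<le> card (rcosets H) * k"
    using lag le by (simp_all add: k)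
  then have "card (rcosets H) \<le> 1"
    using pos(2) by linarith
  then have "card (carrier G) \<le> card H"
    using mult_le_mono1[of "card (rcosets H)" 1 "card H"] by (simp only: lag order_def mult_1)
  then show ?thesis
    using Hsub fin by (intro card_seteq) auto
qed

lemma (in group) conjugate_by_closed:
  "s \<in> carrier G \<Longrightarrow> g \<in> carrier G \<Longrightarrow> conjugate_by G s g \<in> carrier G"
  by (simp add: conjugate_by_def)

text \<open>Whatever conjugators are chosen, the subgroup obtained contains a conjugate of every
  element, so its own conjugates cover the group. This shows that the minimum in
  \<open>min_inv_gen\<close> is taken over a nonempty set.\<close>

lemma (in group) invariably_generates_carrier:
  assumes "finite (carrier G)"
  shows "invariably_generates G (carrier G)"
  unfolding invariably_generates_def
proof (intro conjI ballI)
  fix g assume g: "g \<in> carrier G \<rightarrow> carrier G"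
  let ?C = "(\<lambda>s. conjugate_by G s (g s)) ` carrier G"
  have "?C \<subseteq> carrier G"
    using g by (auto intro: conjugate_by_closed)
  then have "subgroup (generate G ?C) G"
    by (rule generate_is_subgroup)
  then show "generate G ?C = carrier G"
  proof (rule conjugates_cover_imp_eq_carrier[OF assms])
    fix x assume "x \<in> carrier G"
    then show "\<exists>h\<in>carrier G. inv h \<otimes> x \<otimes> h \<in> generate G ?C"
      using g by (intro bexI[of _ "g x"] generate.incl) (auto simp: conjugate_by_def)
  qed
qed simp

section \<open>Isomorphism invariance and transport to the natural numbers\<close>

lemma iso_generates:
  assumes "group G" "group H" "h \<in> iso G H" "generates G S"
  shows "generates H (h ` S)"
proof -
  interpret group_hom G H h
    using assms by (simp add: group_hom_def group_hom_axioms_def iso_def)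
  have "h ` carrier G = carrier H"
    using assms(3) by (simp add: iso_def bij_betw_def)
  then show ?thesis
    using assms(4) by (auto simp: generates_def generate_img)
qed

lemma iso_invariably_generates:
  assumes "group G" "group H" "h \<in> iso G H" "invariably_generates G S"
  shows "invariably_generates H (h ` S)"
proof -
  interpret group_hom G H h
    using assms by (simp add: group_hom_def group_hom_axioms_def iso_def)
  have im: "h ` carrier G = carrier H"
    using assms(3) by (simp add: iso_def bij_betw_def)
  have S: "S \<subseteq> carrier G"
    using assms(4) by (simp add: invariably_generates_def)
  show ?thesis
    unfolding invariably_generates_def
  proof (intro conjI ballI)
    show "h ` S \<subseteq> carrier H"
      using S by auto
    fix g assume g: "g \<in> h ` S \<rightarrow> carrier H"
    then have "\<forall>s\<in>S. \<exists>x. x \<in> carrier G \<and> h x = g (h s)"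
      using im by (metis Pi_iff imageE image_eqI)
    then obtain k where k: "\<And>s. s \<in> S \<Longrightarrow> k s \<in> carrier G \<and> h (k s) = g (h s)"
      by metis
    have "(\<lambda>s. conjugate_by H s (g s)) ` h ` S = h ` (\<lambda>s. conjugate_by G s (k s)) ` S"
      unfolding image_image using k S by (intro image_cong refl) (auto simp: conjugate_by_def subset_iff)
    moreover have "(\<lambda>s. conjugate_by G s (k s)) ` S \<subseteq> carrier G"
      using k S by (auto simp: conjugate_by_def subset_iff)
    moreover have "generate G ((\<lambda>s. conjugate_by G s (k s)) ` S) = carrier G"
      using assms(4) k by (auto simp: invariably_generates_def)
    ultimately show "generate H ((\<lambda>s. conjugate_by H s (g s)) ` h ` S) = carrier H"
      using im by (simp add: generate_img)
  qed
qed

lemma card_image_iso: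
  assumes iso: "h \<in> iso G H" and S: "S \<subseteq> carrier G"
  shows "card (h ` S) = card S"
  using assms by (intro card_image) (auto simp: iso_def bij_betw_def intro: inj_on_subset)

lemma is_iso_ex_generating_card:
  assumes G: "group G" and H: "group H" and iso: "G \<cong> H"
  shows "(\<exists>S. finite S \<and> generates G S \<and> card S = n) \<Longrightarrow> \<exists>S. finite S \<and> generates H S \<and> card S = n"
    and "(\<exists>S. finite S \<and> invariably_generates G S \<and> card S = n) \<Longrightarrow>
      \<exists>S. finite S \<and> invariably_generates H S \<and> card S = n"
proof -
  obtain h where h: "h \<in> iso G H"
    using iso by (auto simp: is_iso_def)
  show "(\<exists>S. finite S \<and> generates G S \<and> card S = n) \<Longrightarrow> \<exists>S. finite S \<and> generates H S \<and> card S = n"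
    using iso_generates[OF G H h] card_image_iso[OF h] by (metis finite_imageI generates_def)
  show "(\<exists>S. finite S \<and> invariably_generates G S \<and> card S = n) \<Longrightarrow>
      \<exists>S. finite S \<and> invariably_generates H S \<and> card S = n"
    using iso_invariably_generates[OF G H h] card_image_iso[OF h] by (metis finite_imageI invariably_generates_def)
qed

lemma is_iso_min_gen_eq:
  assumes "group G" "group H" "G \<cong> H"
  shows "min_gen G = min_gen H" and "min_inv_gen G = min_inv_gen H"
proof -
  have "H \<cong> G"
    using assms group.iso_sym by blast
  note le = is_iso_ex_generating_card[OF assms] is_iso_ex_generating_card[OF assms(2,1) this]
  show "min_gen G = min_gen H"
    unfolding min_gen_def by (intro arg_cong[where f = Least] ext iffI; erule le)
  show "min_inv_gen G = min_inv_gen H"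
    unfolding min_inv_gen_def by (intro arg_cong[where f = Least] ext iffI; erule le)
qed

text \<open>The structure is transported along an injection of the carrier into the naturals; this
  brings the group built from tuples of permutations to the type \<open>nat monoid\<close>.\<close>

lemma (in group) ex_nat_monoid_iso:
  assumes "finite (carrier G)"
  shows "\<exists>H :: nat monoid. group H \<and> G \<cong> H"
proof -
  obtain f :: "'a \<Rightarrow> nat" where f: "inj_on f (carrier G)"
    using finite_imp_inj_to_nat_seg[OF assms] by blast
  define H where "H = \<lparr>carrier = f ` carrier G,
    monoid.mult = (\<lambda>x y. f (inv_into (carrier G) f x \<otimes> inv_into (carrier G) f y)), one = f \<one>\<rparr>"
  have "f \<in> iso G H"
    using f by (auto simp: iso_def hom_def H_def bij_betw_def)
  \<comment> \<open>\<open>iso_imp_img_group\<close> yields a group with its unit set to the image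
    of the unit; here that update changes nothing.\<close>
  moreover have "H = H\<lparr>one := f \<one>\<rparr>"
    by (simp add: H_def)
  ultimately have "group H"
    by (metis iso_imp_img_group)
  with \<open>f \<in> iso G H\<close> show ?thesis
    unfolding is_iso_def by blast
qed

section \<open>Criteria for the two minima\<close>

lemma (in group) generate_card_le_1_commute:
  assumes S: "finite S" "S \<subseteq> carrier G" "card S \<le> 1"
    and xy: "x \<in> generate G S" "y \<in> generate G S"
  shows "x \<otimes> y = y \<otimes> x"
proof -
  \<comment> \<open>Inclusion instead of equality also covers the empty set; either way everything
    lies in a cyclic subgroup.\<close>
  obtain a where a: "a \<in> carrier G" "S \<subseteq> {a}"
    using S by (metis One_nat_def card_le_Suc0_iff_eq empty_subsetI insertI1 one_closed subsetD subsetI singletonI subset_singletonD)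
  have "x \<in> generate G {a}" "y \<in> generate G {a}"
    using xy mono_generate[OF a(2)] by auto
  then show ?thesis
    using a(1) by (auto simp: generate_pow int_pow_mult[symmetric] add.commute)
qed

lemma (in group) min_gen_eq_2:
  assumes ab: "generates G {a, b}" and xy: "x \<in> carrier G" "y \<in> carrier G" "x \<otimes> y \<noteq> y \<otimes> x"
  shows "min_gen G = 2"
  unfolding min_gen_def
proof (rule Least_equality)
  have ge: "2 \<le> card S" if "finite S" "generates G S" for S
  proof (rule ccontr)
    assume "\<not> 2 \<le> card S"
    then have "card S \<le> 1" by simp
    then show False
      using generate_card_le_1_commute[of S x y] that xy by (auto simp: generates_def)
  qed
  \<comment> \<open>That \<open>a\<close> and \<open>b\<close> are distinct follows from
    \<open>ge\<close> applied to \<open>{a, b}\<close> itself.\<close>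
  have "card {a, b} \<le> 2"
    by (simp add: card_insert_if)
  then have "card {a, b} = 2"
    by (rule le_antisym) (rule ge[OF _ ab], simp)
  then show "\<exists>S. finite S \<and> generates G S \<and> card S = 2"
    using ab by (metis finite.emptyI finite.insertI)
  show "2 \<le> n" if "\<exists>S. finite S \<and> generates G S \<and> card S = n" for n
    using that ge by auto
qed

lemma (in group) min_inv_gen_ge:
  assumes "finite (carrier G)"
    and "\<And>S. finite S \<Longrightarrow> invariably_generates G S \<Longrightarrow> r \<le> card S"
  shows "r \<le> min_inv_gen G"
proof -
  have "\<exists>n S. finite S \<and> invariably_generates G S \<and> card S = n"
    using invariably_generates_carrier assms(1) by blast
  then have "\<exists>S. finite S \<and> invariably_generates G S \<and> card S = min_inv_gen G"
    unfolding min_inv_gen_def by (rule LeastI_ex)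
  then obtain S where "finite S" "invariably_generates G S" "card S = min_inv_gen G"
    by blast
  then show ?thesis
    using assms(2)[of S] by simp
qed

section \<open>Classes of permutations under even conjugation\<close>

text \<open>Where \<open>p k \<noteq> k + 1\<close>, the value \<open>p k\<close> is the only element of \<open>{1..k}\<close> not attained on \<open>{1..<k}\<close>,
  so such a permutation is encoded by a subset of \<open>{1..n}\<close>.\<close>

lemma permutes_le_Suc_eqI:
  fixes p q :: "nat \<Rightarrow> nat"
  assumes p: "p permutes {1..n}" "\<And>k. k \<in> {1..n} \<Longrightarrow> p k \<le> Suc k"
    and q: "q permutes {1..n}" "\<And>k. k \<in> {1..n} \<Longrightarrow> q k \<le> Suc k"
    and eq: "{k \<in> {1..n}. p k = Suc k} = {k \<in> {1..n}. q k = Suc k}"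
  shows "p = q"
proof
  fix k show "p k = q k"
  proof (induction k rule: less_induct)
    case (less k)
    show ?case
    proof (cases "k \<in> {1..n}")
      case False
      then show ?thesis
        using p(1) q(1) by (simp add: permutes_not_in)
    next
      case k: True
      show ?thesis
      proof (cases "p k = Suc k")
        case True
        with k eq have "q k = Suc k"
          by blast
        with True show ?thesis by simp
      next
        case False
        with k eq have "q k \<noteq> Suc k"
          by blast
        have A: "r k \<in> {1..k} - r ` {1..<k}"
          if r: "r permutes {1..n}" "\<And>k. k \<in> {1..n} \<Longrightarrow> r k \<le> Suc k" "r k \<noteq> Suc k" for r
        proof -
          have "r k \<in> {1..n}"
            using r(1) k by (simp only: permutes_in_image)
          moreover have "r k \<le> k"
            using r(2)[OF k] r(3) by simp
          moreover have "r k \<notin> r ` {1..<k}"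
            using permutes_inj[OF r(1)] by (simp add: inj_image_mem_iff)
          ultimately show ?thesis by simp
        qed
        have sub: "p ` {1..<k} \<subseteq> {1..k}"
        proof
          fix y assume "y \<in> p ` {1..<k}"
          then obtain x where x: "x \<in> {1..<k}" "y = p x" by blast
          with k have "x \<in> {1..n}" by auto
          with p(2)[OF this] permutes_in_image[OF p(1), of x] x show "y \<in> {1..k}" by auto
        qed
        have "card (p ` {1..<k}) = k - 1"
          using permutes_inj_on[OF p(1)] by (subst card_image) auto
        with sub have "card ({1..k} - p ` {1..<k}) = 1"
          using k by (subst card_Diff_subset) auto
        \<comment> \<open>By induction both permutations leave the same single value of
          \<open>{1..k}\<close> free, and both must take it at \<open>k\<close>.\<close>
        moreover have "q ` {1..<k} = p ` {1..<k}"
          using less.IH by (intro image_cong) auto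
        ultimately show ?thesis
          using A[OF p False] A[OF q \<open>q k \<noteq> Suc k\<close>] by (metis card_1_singletonE singletonD)
      qed
    qed
  qed
qed

text \<open>Numbering the points consecutively along the cycles sends each label either to its
  successor or back to the start of its cycle. The conjugator \<open>u\<close> is this renumbering,
  built one label at a time.\<close>

lemma ex_conjugate_le_Suc:
  fixes p :: "nat \<Rightarrow> nat"
  assumes p: "p permutes {1..n}"
  shows "\<exists>u. u permutes {1..n} \<and> (\<forall>k\<in>{1..n}. (inv' u \<circ> p \<circ> u) k \<le> Suc k)"
proof -
  have "m \<le> n \<Longrightarrow> \<exists>u. u permutes {1..n} \<and> (\<forall>k\<in>{1..m}. (inv' u \<circ> p \<circ> u) k \<le> Suc k)" for m
  proof (induction m)
    case 0
    then show ?case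
      using permutes_id by (intro exI[of _ id] conjI, blast) auto
  next
    case (Suc m)
    then obtain u where u: "u permutes {1..n}" "\<And>k. k \<in> {1..m} \<Longrightarrow> (inv' u \<circ> p \<circ> u) k \<le> Suc k"
      by auto
    define v where "v = (inv' u \<circ> p \<circ> u) (Suc m)"
    show ?case
    proof (cases "v \<le> Suc (Suc m)")
      case True
      then have "\<forall>k\<in>{1..Suc m}. (inv' u \<circ> p \<circ> u) k \<le> Suc k"
        using u(2) by (auto simp: v_def atLeastAtMostSuc_conv)
      with u(1) show ?thesis by blast
    next
      case False
      have "(inv' u \<circ> p \<circ> u) permutes {1..n}"
        using u(1) p by (intro permutes_compose permutes_inv)
      then have v: "v \<in> {1..n}"
        unfolding v_def by (subst permutes_in_image) (use Suc.prems in auto)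
      \<comment> \<open>Exchanging the labels \<open>m + 2\<close> and \<open>v\<close> sends
        \<open>m + 1\<close> to \<open>m + 2\<close>. Labels \<open>k \<le> m\<close> have images at
        most \<open>m + 1 < m + 2 < v\<close>, so these are undisturbed.\<close>
      let ?t = "Transposition.transpose (Suc (Suc m)) v"
      have t: "?t permutes {1..n}"
        using v False by (intro permutes_swap_id) auto
      have iv: "inv' (u \<circ> ?t) = ?t \<circ> inv' u"
        using u(1) by (simp add: o_inv_distrib permutes_bij)
      have "(inv' (u \<circ> ?t) \<circ> p \<circ> (u \<circ> ?t)) k \<le> Suc k" if k: "k \<in> {1..Suc m}" for k
      proof (cases "k = Suc m")
        case True
        then show ?thesis
          using False by (simp add: iv v_def[unfolded comp_def, symmetric])
      next
        case km: False
        then have km: "k \<in> {1..m}"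
          using k by auto
        then have "inv' u (p (u k)) \<le> Suc k"
          using u(2) by simp
        then show ?thesis
          using km False by (simp add: iv)
      qed
      then show ?thesis
        using permutes_compose[OF t u(1)] by blast
    qed
  qed
  then show ?thesis by blast
qed

text \<open>The colour of \<open>p\<close> is the subset encoding its normal form
  \<open>d p\<close>, together with the parity of the normalising conjugator \<open>u p\<close>.
  Equal colours give equal normal forms, and then \<open>u q \<circ> inv' (u p)\<close> carries
  \<open>p\<close> to \<open>q\<close> and is even because the parities agree.\<close>

lemma ex_alt_class_colouring:
  "\<exists>c :: (nat \<Rightarrow> nat) \<Rightarrow> nat set \<times> bool. range c \<subseteq> Pow {1..n} \<times> UNIV \<and>
     (\<forall>p q. p permutes {1..n} \<longrightarrow> q permutes {1..n} \<longrightarrow> c p = c q \<longrightarrow>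
       (\<exists>u. u permutes {1..n} \<and> evenperm u \<and> q = u \<circ> p \<circ> inv' u))"
proof -
  obtain u where u: "\<And>p. p permutes {1..n} \<Longrightarrow>
      u p permutes {1..n} \<and> (\<forall>k\<in>{1..n}. (inv' (u p) \<circ> p \<circ> u p) k \<le> Suc k)"
    using ex_conjugate_le_Suc[of _ n] by (atomize_elim, intro choice) blast
  define d where "d p = inv' (u p) \<circ> p \<circ> u p" for p
  define c where "c p = ({k \<in> {1..n}. d p k = Suc k}, evenperm (u p))" for p
  have "\<exists>w. w permutes {1..n} \<and> evenperm w \<and> q = w \<circ> p \<circ> inv' w"
    if p: "p permutes {1..n}" and q: "q permutes {1..n}" and eq: "c p = c q" for p q
  proof -
    have up: "u p permutes {1..n}" and uq: "u q permutes {1..n}"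
      using u p q by auto
    have perm: "permutation (u p)" "permutation (u q)"
      using up uq by (auto simp: permutation_permutes)
    have dp: "d p permutes {1..n}" "d q permutes {1..n}"
      unfolding d_def using p q up uq by (auto intro!: permutes_compose permutes_inv)
    have "d p = d q"
      using eq u p q dp by (intro permutes_le_Suc_eqI[of _ n]) (auto simp: c_def d_def)
    then have "u q \<circ> d p \<circ> inv' (u q) = u q \<circ> d q \<circ> inv' (u q)"
      by simp
    also have "\<dots> = (u q \<circ> inv' (u q)) \<circ> q \<circ> (u q \<circ> inv' (u q))"
      by (simp add: d_def comp_assoc)
    also have "\<dots> = q"
      using uq by (simp add: permutes_inv_o)
    finally have "q = (u q \<circ> inv' (u p)) \<circ> p \<circ> (u p \<circ> inv' (u q))"
      by (simp add: d_def comp_assoc)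
    moreover have "inv' (u q \<circ> inv' (u p)) = u p \<circ> inv' (u q)"
      using permutes_bij[OF up] permutes_bij[OF uq] by (simp add: o_inv_distrib bij_imp_bij_inv inv_inv_eq)
    moreover have "evenperm (u q \<circ> inv' (u p))"
      using eq perm by (simp add: c_def evenperm_comp permutation_inverse evenperm_inv)
    moreover have "(u q \<circ> inv' (u p)) permutes {1..n}"
      using up uq by (intro permutes_compose permutes_inv)
    ultimately show ?thesis by metis
  qed
  moreover have "range c \<subseteq> Pow {1..n} \<times> UNIV"
    by (auto simp: c_def)
  ultimately show ?thesis by blast
qed

section \<open>Generating alternating and symmetric groups\<close>

text \<open>A permutation handling the tails is followed by the transposition of \<open>p x\<close>
  and \<open>y\<close>; neither point occurs in \<open>ys\<close>, so the tails stay
  matched.\<close>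

lemma ex_permutes_map_eq:
  assumes "length xs = length ys" "distinct xs" "distinct ys" "set xs \<subseteq> A" "set ys \<subseteq> A"
  shows "\<exists>p. p permutes A \<and> map p xs = ys"
  using assms
proof (induction xs ys rule: list_induct2)
  case Nil
  then show ?case
    using permutes_id by (intro exI[of _ id] conjI, blast) auto
next
  case (Cons x xs y ys)
  then obtain p where p: "p permutes A" "map p xs = ys"
    by auto
  let ?t = "Transposition.transpose (p x) y"
  have "p x \<in> A"
    using p(1) Cons.prems by (simp add: permutes_in_image)
  then have "(?t \<circ> p) permutes A"
    using p(1) Cons.prems by (intro permutes_compose permutes_swap_id) auto
  moreover have "?t (p z) = p z" if "z \<in> set xs" for z
  proof (rule transpose_apply_other)
    show "p z \<noteq> p x"
      using that Cons.prems permutes_inj[OF p(1)] by (auto simp: inj_eq)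
    show "p z \<noteq> y"
      using that Cons.prems p(2) by auto
  qed
  then have "map (?t \<circ> p) xs = map p xs"
    by (intro map_cong refl) (simp only: comp_apply)
  with p(2) have "map (?t \<circ> p) (x # xs) = y # ys"
    by simp
  ultimately show ?case
    by (rule_tac exI[of _ "?t \<circ> p"]) (rule conjI)
qed

text \<open>All 3-cycles are conjugate in the symmetric group, and they generate the alternating
  group.\<close>

lemma alt_group_subset_normal:
  assumes N: "N \<lhd> sym_group n" and q: "q \<in> N" "q \<in> three_cycles n"
  shows "carrier (alt_group n) \<subseteq> N"
proof -
  interpret N: normal N "sym_group n" by fact
  have "three_cycles n \<subseteq> N"
  proof
    fix p assume "p \<in> three_cycles n"
    then obtain ds where ds: "p = cycle_of_list ds" "cycle ds" "length ds = 3" "set ds \<subseteq> {1..n}"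
      by blast
    obtain cs where cs: "q = cycle_of_list cs" "cycle cs" "length cs = 3" "set cs \<subseteq> {1..n}"
      using q(2) by blast
    obtain u where u: "u permutes {1..n}" "map u cs = ds"
      using ex_permutes_map_eq[of cs ds "{1..n}"] cs ds by auto
    then have "u \<otimes>\<^bsub>sym_group n\<^esub> q \<otimes>\<^bsub>sym_group n\<^esub> inv\<^bsub>sym_group n\<^esub> u \<in> N"
      using q(1) by (intro N.inv_op_closed2) (auto simp: sym_group_carrier)
    moreover have "u \<otimes>\<^bsub>sym_group n\<^esub> q \<otimes>\<^bsub>sym_group n\<^esub> inv\<^bsub>sym_group n\<^esub> u = p"
      using conjugation_of_cycle[OF cs(2) permutes_bij[OF u(1)]] u
      by (simp add: sym_group_mult sym_group_carrier ds(1) cs(1))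
    ultimately show "p \<in> N" by simp
  qed
  moreover have "generate (alt_group n) (three_cycles n) = generate (sym_group n) (three_cycles n)"
    using group.generate_consistent[OF sym_group_is_group three_cycles_incl alt_group_is_subgroup]
    by (simp add: alt_group_def)
  ultimately show ?thesis
    using N.generate_subgroup_incl[OF _ N.is_subgroup] by (simp add: alt_group_carrier_as_three_cycles)
qed

text \<open>For a point \<open>a\<close> moved by \<open>z\<close>, take \<open>s = (a 1 2)\<close>.
  As \<open>z\<close> fixes 1 and 2, the conjugate of \<open>s\<close> is \<open>(z a 1 2)\<close>;
  in the commutator the two factors \<open>(1 2)\<close> cancel and \<open>(z a 1 a)\<close>
  remains.\<close>

lemma commutator_three_cycle:
  assumes z: "z permutes {1..n}" "z 1 = 1" "z 2 = 2" "z \<noteq> id"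
  obtains s where "s \<in> three_cycles n" "z \<circ> s \<circ> inv' z \<circ> inv' s \<in> three_cycles n"
proof -
  obtain a where a: "z a \<noteq> a"
    using z(4) by (auto simp: fun_eq_iff)
  have a_in: "a \<in> {1..n}"
    using a z(1) by (meson permutes_not_in)
  have b_in: "z a \<in> {1..n}"
    using a_in z(1) by (simp only: permutes_in_image)
  have a12: "a \<noteq> 1" "a \<noteq> 2"
    using a z by auto
  have b12: "z a \<noteq> 1" "z a \<noteq> 2"
    using a12 z permutes_inj[OF z(1)] by (metis injD)+
  have n: "2 \<le> n"
    using a_in a12 by auto
  let ?s = "cycle_of_list [a, 1, 2]"
  have "z \<circ> ?s \<circ> inv' z = cycle_of_list (map z [a, 1, 2])"
    using a12 by (intro conjugation_of_cycle permutes_bij[OF z(1)]) auto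
  also have "\<dots> = Transposition.transpose (z a) 1 \<circ> Transposition.transpose 1 2"
    using z by simp
  finally have conj: "z \<circ> ?s \<circ> inv' z = Transposition.transpose (z a) 1 \<circ> Transposition.transpose 1 2" .
  have iv: "inv' ?s = Transposition.transpose 1 2 \<circ> Transposition.transpose a 1"
    by (simp add: o_inv_distrib)
  have "z \<circ> ?s \<circ> inv' z \<circ> inv' ?s = Transposition.transpose (z a) 1 \<circ>
      (Transposition.transpose 1 2 \<circ> Transposition.transpose 1 2) \<circ> Transposition.transpose a 1"
    unfolding conj iv by (simp only: comp_assoc)
  also have "\<dots> = cycle_of_list [z a, 1, a]"
    by (simp add: transpose_commute)
  finally have comm: "z \<circ> ?s \<circ> inv' z \<circ> inv' ?s = cycle_of_list [z a, 1, a]" .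
  have "cycle_of_list [z a, 1, a] \<in> three_cycles n"
    using a a_in b_in a12 b12 n by (intro CollectI exI[of _ "[z a, 1, a]"]) auto
  moreover have "?s \<in> three_cycles n"
    using a a_in a12 n by (intro CollectI exI[of _ "[a, 1, 2]"]) auto
  ultimately show ?thesis
    by (intro that[of ?s]) (simp_all only: comm)
qed

text \<open>The cycle \<open>(2 3 ... n)\<close>. It rotates the star of transpositions
  \<open>(1 k)\<close> around the fixed centre 1.\<close>

definition star_cycle :: "nat \<Rightarrow> nat \<Rightarrow> nat" where
  "star_cycle n k = (if k \<in> {2..<n} then Suc k else if k = n then 2 else k)"

lemma star_cycle_permutes:
  assumes "2 \<le> n"
  shows "star_cycle n permutes {1..n}"
proof (rule inj_imp_permutes)
  show "inj_on (star_cycle n) {1..n}"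
    using assms by (auto simp: star_cycle_def inj_on_def split: if_splits)
qed (use assms in \<open>auto simp: star_cycle_def\<close>)

text \<open>Repeated conjugation of \<open>(1 2)\<close> by the cycle gives every
  \<open>(1 k)\<close>; then \<open>(a b) = (1 a)(1 b)(1 a)\<close>, and transpositions generate the
  symmetric group.\<close>

lemma sym_group_generated_by_star:
  assumes n: "2 \<le> n" and D: "subgroup D (sym_group n)"
    and x: "star_cycle n \<in> D" and t: "Transposition.transpose 1 2 \<in> D"
  shows "D = carrier (sym_group n)"
proof
  interpret D: subgroup D "sym_group n" by fact
  show "D \<subseteq> carrier (sym_group n)"
    by (rule D.subset)
  have comp: "p \<circ> q \<in> D" if "p \<in> D" "q \<in> D" for p q
    using D.m_closed[OF that] by (simp add: sym_group_mult)
  have inv_x: "inv' (star_cycle n) \<in> D"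
    using D.m_inv_closed[OF x] D.subset x by auto
  have star: "Transposition.transpose 1 k \<in> D" if "2 \<le> k" "k \<le> n" for k
    using that
  proof (induction k rule: dec_induct)
    case base
    then show ?case using t by simp
  next
    case (step k)
    then have "k \<in> {2..<n}" by auto
    have "star_cycle n \<circ> cycle_of_list [1, k] \<circ> inv' (star_cycle n)
        = cycle_of_list (map (star_cycle n) [1, k])"
      using step by (intro conjugation_of_cycle permutes_bij[OF star_cycle_permutes[OF n]]) auto
    then have "star_cycle n \<circ> Transposition.transpose 1 k \<circ> inv' (star_cycle n) = Transposition.transpose 1 (Suc k)"
      using \<open>k \<in> {2..<n}\<close> n by (simp add: star_cycle_def)
    then show ?case
      using comp[OF comp[OF x step.IH] inv_x] step by simp
  qed
  have star': "Transposition.transpose 1 k \<in> D" if "k \<in> {1..n}" for k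
    using star[of k] that D.one_closed by (cases "k = 1") (auto simp: sym_group_one)
  have transp: "Transposition.transpose a b \<in> D" if "a \<in> {1..n}" "b \<in> {1..n}" "a \<noteq> b" for a b
  proof (cases "a = 1 \<or> b = 1")
    case True
    then show ?thesis
      using star' that by (metis transpose_commute)
  next
    case False
    then have "Transposition.transpose a 1 \<circ> Transposition.transpose 1 b \<circ> Transposition.transpose a 1
        = Transposition.transpose a b"
      using that by (intro transpose_comp_triple) auto
    then show ?thesis
      using comp[OF comp[OF star'[OF that(1)] star'[OF that(2)]] star'[OF that(1)]]
      by (simp add: transpose_commute)
  qed
  show "carrier (sym_group n) \<subseteq> D"
  proof
    fix p assume "p \<in> carrier (sym_group n)"
    then have "p permutes {1..n}" "finite {1..n}"
      by (simp_all add: sym_group_carrier)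
    then show "p \<in> D"
    proof (induction rule: permutes_induct)
      case id
      then show ?case using D.one_closed by (simp add: sym_group_one id_def)
    next
      case (swap a b p)
      then show ?case by (intro comp transp)
    qed
  qed
qed

section \<open>Subgroups of a direct power\<close>

text \<open>Reduces containment of the whole diagonal in \<open>H\<close> to checking it on
  generators of \<open>T\<close>.\<close>

lemma subgroup_diagonal:
  assumes T: "group T" and H: "subgroup H (product_group I (\<lambda>_. T))"
  shows "subgroup {a \<in> carrier T. (\<lambda>i\<in>I. a) \<in> H} T"
proof -
  interpret T: group T by fact
  interpret P: group "product_group I (\<lambda>_. T)"
    using T by simp
  interpret H: subgroup H "product_group I (\<lambda>_. T)" by fact
  show ?thesis
  proof (rule T.subgroupI)
    have "\<one>\<^bsub>T\<^esub> \<in> {a \<in> carrier T. (\<lambda>i\<in>I. a) \<in> H}"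
      using H.one_closed by simp
    then show "{a \<in> carrier T. (\<lambda>i\<in>I. a) \<in> H} \<noteq> {}"
      by blast
  next
    fix a assume a: "a \<in> {a \<in> carrier T. (\<lambda>i\<in>I. a) \<in> H}"
    then have "inv\<^bsub>product_group I (\<lambda>_. T)\<^esub> (\<lambda>i\<in>I. a) \<in> H"
      by (intro H.m_inv_closed) simp
    moreover have "inv\<^bsub>product_group I (\<lambda>_. T)\<^esub> (\<lambda>i\<in>I. a) = (\<lambda>i\<in>I. inv\<^bsub>T\<^esub> a)"
      using a T by (subst inv_product_group) (auto intro!: restrict_ext)
    ultimately show "inv\<^bsub>T\<^esub> a \<in> {a \<in> carrier T. (\<lambda>i\<in>I. a) \<in> H}"
      using a by simp
  next
    fix a b assume ab: "a \<in> {a \<in> carrier T. (\<lambda>i\<in>I. a) \<in> H}" "b \<in> {a \<in> carrier T. (\<lambda>i\<in>I. a) \<in> H}"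
    then have "(\<lambda>i\<in>I. a) \<otimes>\<^bsub>product_group I (\<lambda>_. T)\<^esub> (\<lambda>i\<in>I. b) \<in> H"
      by (intro H.m_closed) simp_all
    moreover have "(\<lambda>i\<in>I. a) \<otimes>\<^bsub>product_group I (\<lambda>_. T)\<^esub> (\<lambda>i\<in>I. b) = (\<lambda>i\<in>I. a \<otimes>\<^bsub>T\<^esub> b)"
      by (auto intro!: restrict_ext)
    ultimately show "a \<otimes>\<^bsub>T\<^esub> b \<in> {a \<in> carrier T. (\<lambda>i\<in>I. a) \<in> H}"
      using ab by simp
  qed simp
qed

text \<open>The projection to coordinate \<open>i\<close> of the kernel of restriction to
  \<open>J\<close>. It is the full projection for empty \<open>J\<close>, and for
  \<open>J = I - {i}\<close> it records the elements of \<open>H\<close> supported at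
  \<open>i\<close> alone.\<close>

definition coordinate_kernel :: "('i \<Rightarrow> 'a) set \<Rightarrow> ('a, 'b) monoid_scheme \<Rightarrow> 'i set \<Rightarrow> 'i \<Rightarrow> 'a set" where
  "coordinate_kernel H T J i = {h i | h. h \<in> H \<and> (\<forall>j\<in>J. h j = \<one>\<^bsub>T\<^esub>)}"

lemma coordinate_kernelI:
  "h \<in> H \<Longrightarrow> (\<And>j. j \<in> J \<Longrightarrow> h j = \<one>\<^bsub>T\<^esub>) \<Longrightarrow> h i = a \<Longrightarrow> a \<in> coordinate_kernel H T J i"
  unfolding coordinate_kernel_def by blast

lemma coordinate_kernelE:
  assumes "a \<in> coordinate_kernel H T J i"
  obtains h where "h \<in> H" "\<forall>j\<in>J. h j = \<one>\<^bsub>T\<^esub>" "h i = a"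
  using assms unfolding coordinate_kernel_def by blast

context
  fixes T :: "('a, 'b) monoid_scheme" and I :: "'i set" and H :: "('i \<Rightarrow> 'a) set"
  assumes T: "group T" and H: "subgroup H (product_group I (\<lambda>_. T))"
begin

interpretation T: group T by (rule T)

interpretation P: group "product_group I (\<lambda>_. T)"
  using T by simp

interpretation H: subgroup H "product_group I (\<lambda>_. T)" by (rule H)

lemma subgroup_product_coordinate: "h \<in> H \<Longrightarrow> i \<in> I \<Longrightarrow> h i \<in> carrier T"
  using H.subset by (auto simp: PiE_iff)

lemma subgroup_product_mult:
  assumes "h \<in> H" "k \<in> H"
  shows "(\<lambda>i\<in>I. h i \<otimes>\<^bsub>T\<^esub> k i) \<in> H"
  using H.m_closed[OF assms] by simp

lemma subgroup_product_inv:
  assumes "h \<in> H"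
  shows "(\<lambda>i\<in>I. inv\<^bsub>T\<^esub> h i) \<in> H"
proof -
  have "h \<in> (\<Pi>\<^sub>E i\<in>I. carrier T)"
    using assms H.subset by auto
  then show ?thesis
    using H.m_inv_closed[OF assms] T by simp
qed

text \<open>Conjugation by a constant tuple stays in \<open>H\<close>, keeps entries on
  \<open>J\<close> trivial, and conjugates entry \<open>i\<close> by an arbitrary element of
  \<open>T\<close>.\<close>

lemma coordinate_kernel_normal:
  assumes diag: "\<And>a. a \<in> carrier T \<Longrightarrow> (\<lambda>i\<in>I. a) \<in> H" and J: "J \<subseteq> I" and i: "i \<in> I"
  shows "coordinate_kernel H T J i \<lhd> T"
proof (rule T.normal_invI)
  have coord: "h j \<in> carrier T" if "h \<in> H" "j \<in> insert i J" for h j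
    using subgroup_product_coordinate that J i by blast
  show "subgroup (coordinate_kernel H T J i) T"
  proof (rule T.subgroupI)
    show "coordinate_kernel H T J i \<subseteq> carrier T"
      using coord by (auto elim: coordinate_kernelE)
    have "\<one>\<^bsub>T\<^esub> \<in> coordinate_kernel H T J i"
      by (rule coordinate_kernelI[OF H.one_closed]) (use J i in auto)
    then show "coordinate_kernel H T J i \<noteq> {}"
      by blast
  next
    fix a assume "a \<in> coordinate_kernel H T J i"
    then obtain h where h: "h \<in> H" "\<forall>j\<in>J. h j = \<one>\<^bsub>T\<^esub>" "h i = a"
      by (rule coordinate_kernelE)
    show "inv\<^bsub>T\<^esub> a \<in> coordinate_kernel H T J i"
      by (rule coordinate_kernelI[OF subgroup_product_inv[OF h(1)]]) (use h J i in auto)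
  next
    fix a b assume "a \<in> coordinate_kernel H T J i" "b \<in> coordinate_kernel H T J i"
    then obtain h k where h: "h \<in> H" "\<forall>j\<in>J. h j = \<one>\<^bsub>T\<^esub>" "h i = a"
      and k: "k \<in> H" "\<forall>j\<in>J. k j = \<one>\<^bsub>T\<^esub>" "k i = b"
      by (elim coordinate_kernelE)
    show "a \<otimes>\<^bsub>T\<^esub> b \<in> coordinate_kernel H T J i"
      by (rule coordinate_kernelI[OF subgroup_product_mult[OF h(1) k(1)]]) (use h k J i in auto)
  qed
next
  fix x a assume x: "x \<in> carrier T" and "a \<in> coordinate_kernel H T J i"
  then obtain h where h: "h \<in> H" "\<forall>j\<in>J. h j = \<one>\<^bsub>T\<^esub>" "h i = a"
    by (elim coordinate_kernelE)
  note mem = subgroup_product_mult[OF subgroup_product_mult[OF diag[OF x] h(1)] diag[OF T.inv_closed[OF x]]]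
  show "x \<otimes>\<^bsub>T\<^esub> a \<otimes>\<^bsub>T\<^esub> inv\<^bsub>T\<^esub> x \<in> coordinate_kernel H T J i"
    by (rule coordinate_kernelI[OF mem]) (use x h J i in auto)
qed

text \<open>A commutator is trivial at every coordinate where one of its two elements is trivial, so
  the sets \<open>{j}\<close> and \<open>J\<close> add up.\<close>

lemma commutator_in_coordinate_kernel_insert:
  assumes a: "a \<in> coordinate_kernel H T {j} i" and b: "b \<in> coordinate_kernel H T J i"
    and J: "insert j J \<subseteq> I" and i: "i \<in> I"
  shows "a \<otimes>\<^bsub>T\<^esub> b \<otimes>\<^bsub>T\<^esub> inv\<^bsub>T\<^esub> a \<otimes>\<^bsub>T\<^esub> inv\<^bsub>T\<^esub> b \<in> coordinate_kernel H T (insert j J) i"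
proof -
  obtain h where h: "h \<in> H" "h j = \<one>\<^bsub>T\<^esub>" "h i = a"
    using a by (auto elim: coordinate_kernelE)
  obtain k where k: "k \<in> H" "\<forall>l\<in>J. k l = \<one>\<^bsub>T\<^esub>" "k i = b"
    using b by (rule coordinate_kernelE)
  have coord: "h l \<in> carrier T" "k l \<in> carrier T" if "l \<in> insert j J" for l
    using subgroup_product_coordinate h(1) k(1) that J by blast+
  note mem = subgroup_product_mult[OF subgroup_product_mult[OF
      subgroup_product_mult[OF h(1) k(1)] subgroup_product_inv[OF h(1)]] subgroup_product_inv[OF k(1)]]
  show ?thesis
    by (rule coordinate_kernelI[OF mem]) (use h k J i coord in \<open>auto simp: subset_iff T.m_assoc\<close>)
qed

section \<open>Pigeonhole bound for invariable generation\<close>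

text \<open>If two coordinates had the same colours for all of \<open>S\<close>, suitable
  conjugators supported at one of them would make all elements agree there, confining the generated
  subgroup to a proper one. Hence coordinates inject into colour patterns on
  \<open>S\<close>.\<close>

lemma card_le_of_invariably_generates:
  assumes single: "\<And>i a. i \<in> I \<Longrightarrow> a \<in> N \<Longrightarrow> (\<lambda>j\<in>I. if j = i then a else \<one>\<^bsub>T\<^esub>) \<in> H"
    and colour: "\<And>p q. p \<in> carrier T \<Longrightarrow> q \<in> carrier T \<Longrightarrow> c p = c q \<Longrightarrow>
      \<exists>u\<in>N. q = u \<otimes>\<^bsub>T\<^esub> p \<otimes>\<^bsub>T\<^esub> inv\<^bsub>T\<^esub> u"
    and N: "N \<subseteq> carrier T"
    and C: "c ` carrier T \<subseteq> C" "finite C"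
    and separate: "\<And>i j. i \<in> I \<Longrightarrow> j \<in> I \<Longrightarrow> (\<And>h. h \<in> H \<Longrightarrow> h i = h j) \<Longrightarrow> i = j"
    and S: "finite S" "invariably_generates (product_group I (\<lambda>_. T)\<lparr>carrier := H\<rparr>) S"
  shows "card I \<le> card C ^ card S"
proof -
  let ?P = "product_group I (\<lambda>_. T)"
  let ?G = "?P\<lparr>carrier := H\<rparr>"
  have S_sub: "S \<subseteq> H"
    using S(2) by (simp add: invariably_generates_def)
  define F where "F i = (\<lambda>s\<in>S. c (s i))" for i
  have "inj_on F I"
  proof (rule inj_onI)
    fix i j assume i: "i \<in> I" and j: "j \<in> I" and F: "F i = F j"
    show "i = j"
    proof (rule ccontr)
      assume "i \<noteq> j"
      have "\<exists>u\<in>N. s j = u \<otimes>\<^bsub>T\<^esub> s i \<otimes>\<^bsub>T\<^esub> inv\<^bsub>T\<^esub> u" if s: "s \<in> S" for s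
      proof (rule colour)
        show "c (s i) = c (s j)"
          using F s unfolding F_def by (metis restrict_apply')
      qed (use s S_sub i j subgroup_product_coordinate in blast)+
      then obtain u where u: "\<And>s. s \<in> S \<Longrightarrow> u s \<in> N \<and> s j = u s \<otimes>\<^bsub>T\<^esub> s i \<otimes>\<^bsub>T\<^esub> inv\<^bsub>T\<^esub> u s"
        by metis
      \<comment> \<open>Acting only at \<open>j\<close>, this conjugator leaves entry
        \<open>i\<close> alone and turns entry \<open>j\<close>, which is \<open>u s\<close> times
        \<open>s i\<close> times the inverse of \<open>u s\<close>, back into
        \<open>s i\<close>.\<close>
      define g where "g s = (\<lambda>l\<in>I. if l = j then u s else \<one>\<^bsub>T\<^esub>)" for s
      have g: "g s \<in> H" if "s \<in> S" for s
        unfolding g_def using single[OF j] u[OF that] by blast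
      define L where "L = {h \<in> H. h i = h j}"
      have "subgroup L ?P"
      proof (rule P.subgroupI)
        show "L \<subseteq> carrier ?P"
          using H.subset by (auto simp: L_def)
        show "L \<noteq> {}"
          using H.one_closed i j by (auto simp: L_def)
      next
        fix h assume "h \<in> L"
        then show "inv\<^bsub>?P\<^esub> h \<in> L"
          using subgroup_product_inv[of h] H.subset T i j by (auto simp: L_def subset_iff)
      next
        fix h k assume "h \<in> L" "k \<in> L"
        then show "h \<otimes>\<^bsub>?P\<^esub> k \<in> L"
          using subgroup_product_mult[of h k] i j by (auto simp: L_def)
      qed
      moreover have "(\<lambda>s. conjugate_by ?G s (g s)) ` S \<subseteq> L"
      proof
        fix x assume "x \<in> (\<lambda>s. conjugate_by ?G s (g s)) ` S"
        then obtain s where s: "s \<in> S" "x = conjugate_by ?G s (g s)" by blast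
        have gc: "g s \<in> (\<Pi>\<^sub>E i\<in>I. carrier T)"
          using g[OF s(1)] H.subset by auto
        have "x = inv\<^bsub>?P\<^esub> g s \<otimes>\<^bsub>?P\<^esub> s \<otimes>\<^bsub>?P\<^esub> g s"
          using P.m_inv_consistent[OF H g[OF s(1)]] by (simp add: s(2) conjugate_by_def)
        then have x: "x = (\<lambda>l\<in>I. inv\<^bsub>T\<^esub> g s l \<otimes>\<^bsub>T\<^esub> s l \<otimes>\<^bsub>T\<^esub> g s l)"
          using gc T by (auto intro!: restrict_ext)
        have "x \<in> H"
          unfolding x using subgroup_product_mult[OF subgroup_product_mult[OF
              subgroup_product_inv[OF g[OF s(1)]] subsetD[OF S_sub s(1)]] g[OF s(1)]]
          by (simp cong: restrict_cong)
        have c: "u s \<in> carrier T" "s i \<in> carrier T"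
          using u[OF s(1)] N subgroup_product_coordinate S_sub s(1) i by blast+
        have "x i = s i"
          using i \<open>i \<noteq> j\<close> c by (simp add: x g_def)
        also have "s i = inv\<^bsub>T\<^esub> u s \<otimes>\<^bsub>T\<^esub> (u s \<otimes>\<^bsub>T\<^esub> s i \<otimes>\<^bsub>T\<^esub> inv\<^bsub>T\<^esub> u s) \<otimes>\<^bsub>T\<^esub> u s"
          using c by (simp add: T.m_assoc) (simp add: T.m_assoc[symmetric])
        also have "\<dots> = x j"
          using u[OF s(1)] j by (simp add: x g_def)
        finally show "x \<in> L"
          using \<open>x \<in> H\<close> by (simp add: L_def)
      qed
      ultimately have "generate ?P ((\<lambda>s. conjugate_by ?G s (g s)) ` S) \<subseteq> L"
        using P.generate_subgroup_incl by blast
      moreover have "generate ?G ((\<lambda>s. conjugate_by ?G s (g s)) ` S) = H"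
        using S(2) g by (auto simp: invariably_generates_def)
      moreover have "(\<lambda>s. conjugate_by ?G s (g s)) ` S \<subseteq> H"
        using \<open>(\<lambda>s. conjugate_by ?G s (g s)) ` S \<subseteq> L\<close> by (auto simp: L_def)
      ultimately have "H \<subseteq> L"
        using P.generate_consistent[OF _ H] by metis
      \<comment> \<open>By \<open>separate\<close>, some element of \<open>H\<close> has different
        entries at \<open>i\<close> and \<open>j\<close>, so \<open>L\<close> is proper.\<close>
      then show False
        using separate[OF i j] \<open>i \<noteq> j\<close> by (auto simp: L_def)
    qed
  qed
  moreover have "F ` I \<subseteq> S \<rightarrow>\<^sub>E C"
  proof (rule image_subsetI)
    fix i assume "i \<in> I"
    then have "s i \<in> carrier T" if "s \<in> S" for s
      using subgroup_product_coordinate S_sub that by blast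
    then show "F i \<in> S \<rightarrow>\<^sub>E C"
      using C(1) by (auto simp: F_def image_subset_iff)
  qed
  moreover have "finite (S \<rightarrow>\<^sub>E C)"
    using S(1) C(2) by (intro finite_PiE) auto
  ultimately have "card I \<le> card (S \<rightarrow>\<^sub>E C)"
    by (rule card_inj_on_le)
  then show ?thesis
    using S(1) by (simp add: card_funcsetE)
qed

end

section \<open>Even permutations in a single coordinate\<close>

text \<open>Induction on \<open>J\<close> shows that every even permutation occurs at
  \<open>i\<close> in an element of \<open>H\<close> trivial on \<open>J\<close>. To add
  \<open>j\<close>, a commutator produces one 3-cycle trivial on \<open>insert j J\<close>, and
  normality supplies the rest.\<close>

lemma single_coordinate_even:
  fixes I :: "'i set" and n :: nat
  defines "P \<equiv> product_group I (\<lambda>_. sym_group n)"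
  assumes I: "finite I" and H: "subgroup H P"
    and diag: "\<And>a. a permutes {1..n} \<Longrightarrow> (\<lambda>i\<in>I. a) \<in> H"
    and w: "w \<in> H" "inj_on w I" "\<And>i. i \<in> I \<Longrightarrow> w i 1 = 1" "\<And>i. i \<in> I \<Longrightarrow> w i 2 = 2"
    and i: "i \<in> I" and a: "a \<in> carrier (alt_group n)"
  shows "(\<lambda>j\<in>I. if j = i then a else id) \<in> H"
proof -
  note T = sym_group_is_group[of n]
  note H' = H[unfolded P_def]
  have diag': "(\<lambda>i\<in>I. a) \<in> H" if "a \<in> carrier (sym_group n)" for a
    using diag that by (simp add: sym_group_carrier)
  have w_perm: "w j permutes {1..n}" if "j \<in> I" for j
    using subgroup_product_coordinate[OF T H' w(1) that] by (simp add: sym_group_carrier)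
  have "carrier (alt_group n) \<subseteq> coordinate_kernel H (sym_group n) J i"
    if "finite J" "J \<subseteq> I - {i}" for J
    using that
  proof (induction J rule: finite_induct)
    case empty
    show ?case
    proof
      fix b assume "b \<in> carrier (alt_group n)"
      then have "(\<lambda>i\<in>I. b) \<in> H"
        using diag by (simp add: alt_group_carrier)
      then show "b \<in> coordinate_kernel H (sym_group n) {} i"
        by (rule coordinate_kernelI) (use i in auto)
    qed
  next
    case (insert j J)
    then have j: "j \<in> I" "j \<noteq> i" and J: "J \<subseteq> I - {i}"
      by auto
    \<comment> \<open>Dividing \<open>w\<close> by the constant tuple on \<open>w j\<close> kills
      coordinate \<open>j\<close>; coordinate \<open>i\<close> becomes \<open>z\<close>, nontrivial
      since \<open>w\<close> has distinct entries.\<close>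
    define z where "z = w i \<circ> inv' (w j)"
    have z_perm: "z permutes {1..n}"
      unfolding z_def using w_perm i j by (intro permutes_compose permutes_inv)
    have "z \<noteq> id"
    proof
      assume "z = id"
      then have "w i \<circ> (inv' (w j) \<circ> w j) = w j"
        unfolding z_def comp_assoc[symmetric] by simp
      then have "w i = w j"
        using permutes_inv_o(2)[OF w_perm[OF j(1)]] by simp
      with w(2) i j show False
        by (auto dest: inj_onD)
    qed
    have "inv' (w j) 1 = 1" "inv' (w j) 2 = 2"
      using w(3,4) j(1) by (simp_all only: permutes_inv_eq[OF w_perm[OF j(1)]])
    then have fix12: "z 1 = 1" "z 2 = 2"
      using w(3,4) i by (simp_all only: z_def comp_apply)
    have z_mem: "z \<in> coordinate_kernel H (sym_group n) {j} i"
    proof (rule coordinate_kernelI)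
      have "(\<lambda>l\<in>I. inv' (w j)) \<in> H"
        using w_perm[OF j(1)] by (intro diag permutes_inv)
      from subgroup_product_mult[OF T H' w(1) this]
      show "(\<lambda>l\<in>I. w l \<circ> inv' (w j)) \<in> H"
        by (simp add: sym_group_mult cong: restrict_cong)
    qed (use i j permutes_inv_o(1)[OF w_perm[OF j(1)]] in \<open>auto simp: z_def sym_group_one\<close>)
    obtain s where s: "s \<in> three_cycles n" "z \<circ> s \<circ> inv' z \<circ> inv' s \<in> three_cycles n"
      using commutator_three_cycle[OF z_perm fix12 \<open>z \<noteq> id\<close>] by blast
    have s_alt: "s \<in> carrier (alt_group n)"
      using s(1) three_cycles_incl by blast
    have "z \<otimes>\<^bsub>sym_group n\<^esub> s \<otimes>\<^bsub>sym_group n\<^esub> inv\<^bsub>sym_group n\<^esub> z \<otimes>\<^bsub>sym_group n\<^esub> inv\<^bsub>sym_group n\<^esub> s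
        \<in> coordinate_kernel H (sym_group n) (insert j J) i"
      using commutator_in_coordinate_kernel_insert[OF T H' z_mem] insert.IH[OF J] s_alt i j J by blast
    then have "z \<circ> s \<circ> inv' z \<circ> inv' s \<in> coordinate_kernel H (sym_group n) (insert j J) i"
      using z_perm s_alt by (simp add: sym_group_mult sym_group_carrier alt_group_carrier)
    moreover have "coordinate_kernel H (sym_group n) (insert j J) i \<lhd> sym_group n"
      using coordinate_kernel_normal[OF T H' diag'] insert.prems i by blast
    ultimately show ?case
      using alt_group_subset_normal s(2) by blast
  qed
  from this[of "I - {i}"] I a have "a \<in> coordinate_kernel H (sym_group n) (I - {i}) i"
    by blast
  then obtain h where h: "h \<in> H" "\<forall>j\<in>I - {i}. h j = \<one>\<^bsub>sym_group n\<^esub>" "h i = a"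
    by (auto elim: coordinate_kernelE)
  have "h \<in> extensional I"
    using h(1) subgroup.subset[OF H] by (auto simp: P_def PiE_def)
  then have "h = (\<lambda>j\<in>I. if j = i then a else id)"
    using h by (auto intro!: extensionalityI[of _ I] simp: sym_group_one)
  with h(1) show ?thesis by simp
qed

section \<open>Size estimates\<close>

text \<open>A permutation \<open>s\<close> of \<open>m\<close> points yields the product of the 3-cycles
  \<open>(3 + i, 3 + m + i, 3 + 2m + s i)\<close>.\<close>

lemma fact_le_card_order_3:
  "fact m \<le> card {p :: nat \<Rightarrow> nat. p permutes {3..3 * m + 2} \<and> p \<circ> p \<circ> p = id}"
proof -
  define f where "f s x = (if 3 \<le> x \<and> x < 3 + m then x + m
    else if 3 + m \<le> x \<and> x < 3 + 2 * m then 3 + 2 * m + s (x - 3 - m)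
    else if 3 + 2 * m \<le> x \<and> x < 3 + 3 * m then 3 + inv' s (x - 3 - 2 * m) else x)"
    for s :: "nat \<Rightarrow> nat" and x
  let ?A = "{s :: nat \<Rightarrow> nat. s permutes {..<m}}"
  let ?B = "{p :: nat \<Rightarrow> nat. p permutes {3..3 * m + 2} \<and> p \<circ> p \<circ> p = id}"
  have "inj_on f ?A"
  proof (rule inj_onI, rule ext)
    fix s t x assume s: "s \<in> ?A" and t: "t \<in> ?A" and eq: "f s = f t"
    show "s x = t x"
    proof (cases "x < m")
      \<comment> \<open>The values of \<open>s\<close> can be read off from \<open>f s\<close> on
        the middle block.\<close>
      case True
      then show ?thesis
        using fun_cong[OF eq, of "3 + m + x"] by (simp add: f_def)
    next
      case False
      then show ?thesis
        using s t by (auto simp: permutes_def)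
    qed
  qed
  moreover have "f ` ?A \<subseteq> ?B"
  proof
    fix p assume "p \<in> f ` ?A"
    then obtain s where s: "s permutes {..<m}" and p: "p = f s" by blast
    have lt: "s x < m" "inv' s x < m" if "x < m" for x
      using permutes_in_image[OF s, of x] permutes_in_image[OF permutes_inv[OF s], of x] that by auto
    have inv: "s (inv' s x) = x" "inv' s (s x) = x" for x
      using s by (simp_all add: permutes_inverses)
    have mid: "f s (3 + m + y) = 3 + 2 * m + s y" if "y < m" for y
      using that by (simp add: f_def)
    have low: "f s (3 + y) = 3 + m + y" if "y < m" for y
      using that by (simp add: f_def)
    have high: "f s (3 + 2 * m + y) = 3 + inv' s y" if "y < m" for y
      using that by (simp add: f_def)
    have out: "f s x = x" if "x \<notin> {3..3 * m + 2}" for x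
      using that by (auto simp: f_def)
    have cube: "f s (f s (f s x)) = x" for x
    proof (cases "x \<in> {3..3 * m + 2}")
      case True
      then consider y where "y < m" "x = 3 + y" | y where "y < m" "x = 3 + m + y"
        | y where "y < m" "x = 3 + 2 * m + y"
      proof -
        assume *: "\<And>y. y < m \<Longrightarrow> x = 3 + y \<Longrightarrow> thesis" "\<And>y. y < m \<Longrightarrow> x = 3 + m + y \<Longrightarrow> thesis"
          "\<And>y. y < m \<Longrightarrow> x = 3 + 2 * m + y \<Longrightarrow> thesis"
        have "x - 3 < m \<and> x = 3 + (x - 3) \<or> x - 3 - m < m \<and> x = 3 + m + (x - 3 - m) \<or>
            x - 3 - 2 * m < m \<and> x = 3 + 2 * m + (x - 3 - 2 * m)"
          using True by (simp add: atLeastAtMost_iff) arith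
        with * show thesis by blast
      qed
      then show ?thesis
        using lt inv by cases (simp_all only: low mid high)
    next
      case False
      show ?thesis
        by (simp only: out[OF False])
    qed
    \<comment> \<open>Since the cube is the identity, the square of \<open>f s\<close> is its
      inverse, so every point has exactly one preimage.\<close>
    have "p permutes {3..3 * m + 2}"
      unfolding permutes_def p using out cube by metis
    then show "p \<in> ?B"
      using cube by (auto simp: p fun_eq_iff)
  qed
  moreover have "finite ?B"
    by (rule finite_subset[OF _ finite_permutations[of "{3..3 * m + 2}"]]) auto
  ultimately have "card ?A \<le> card ?B"
    by (rule card_inj_on_le)
  then show ?thesis
    by (simp add: card_permutations[OF refl])
qed

text \<open>The terms of the exponential series tend to 0. The threshold \<open>1 / (c + 1)\<close>
  leaves room for one more factor \<open>c\<close> and makes sense for \<open>c = 0\<close>.\<close>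

lemma ex_power_less_fact:
  fixes c :: nat
  shows "\<exists>m\<ge>1. c ^ Suc m < fact m"
proof -
  have "(\<lambda>m. inverse (fact m) * real c ^ m) \<longlonglongrightarrow> 0"
    by (rule summable_LIMSEQ_zero[OF summable_exp])
  then have "eventually (\<lambda>m. inverse (fact m) * real c ^ m < 1 / (real c + 1)) sequentially"
    by (rule order_tendstoD) simp
  moreover have "eventually (\<lambda>m. m \<ge> 1) sequentially"
    by (rule eventually_ge_at_top)
  ultimately have "eventually (\<lambda>m. m \<ge> 1 \<and> inverse (fact m) * real c ^ m < 1 / (real c + 1)) sequentially"
    by eventually_elim simp
  then obtain m where m: "m \<ge> 1" "inverse (fact m) * real c ^ m < 1 / (real c + 1)"
    by (auto simp: eventually_sequentially)
  have "real c ^ m * (real c + 1) < fact m"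
    using m(2) by (simp add: field_simps)
  then have "real c ^ m * real c < fact m"
    using zero_le_power[of "real c" m] unfolding distrib_left mult_1_right by linarith
  then have "real (c ^ Suc m) < real (fact m)"
    by (simp add: mult.commute)
  then show ?thesis
    using m(1) by (metis of_nat_less_iff)
qed

section \<open>Construction of the group and both bounds\<close>

theorem proposition2p5:
  fixes r :: nat
  assumes "r \<ge> 1"
  shows "\<exists>G :: nat monoid. group G \<and> finite (carrier G) \<and> min_gen G = 2 \<and> min_inv_gen G \<ge> r"
proof -
  \<comment> \<open>With \<open>n + 1 = 3 * (m + 1)\<close> the left side is
    \<open>(2 ^ (n + 1)) ^ r\<close>, the number of colour patterns of \<open>r\<close>
    permutations.\<close>
  obtain m where m: "m \<ge> 1" "((2::nat) ^ (3 * r)) ^ Suc m < fact m"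
    using ex_power_less_fact by blast
  define n where "n = 3 * m + 2"
  have n: "5 \<le> n"
    using m(1) by (simp add: n_def)
  define I where "I = {p. p permutes {3..n} \<and> p \<circ> p \<circ> p = id}"
  define P where "P = product_group I (\<lambda>_. sym_group n)"
  define A where "A = (\<lambda>p\<in>I. star_cycle n)"
  define B where "B = (\<lambda>p\<in>I. Transposition.transpose 1 2 \<circ> p)"
  define H where "H = generate P {A, B}"
  define G where "G = P\<lparr>carrier := H\<rparr>"
  have T: "group (sym_group n)"
    by (rule sym_group_is_group)
  interpret P: group P
    unfolding P_def using T by simp

  have finI: "finite I"
    unfolding I_def by (rule finite_subset[OF _ finite_permutations[of "{3..n}"]]) auto
  have I_perm: "p permutes {1..n}" if "p \<in> I" for p
    using that by (auto simp: I_def intro: permutes_subset)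
  have I_fix: "p 1 = 1" "p 2 = 2" if "p \<in> I" for p
    using that by (auto simp: I_def permutes_def)
  \<comment> \<open>A coordinate at which noncommuting constant tuples can be told apart at the
    end.\<close>
  have "id \<in> I"
    using permutes_id by (simp add: I_def)
  have "finite (carrier (sym_group n))"
    using finite_permutations[of "{1..n}"] by (simp add: sym_group_def)
  then have finP: "finite (carrier P)"
    unfolding P_def using finI by (auto intro: finite_PiE)
  have t12: "Transposition.transpose 1 2 permutes {1..n}"
    using n by (intro permutes_swap_id) auto
  have AB: "{A, B} \<subseteq> carrier P"
    using star_cycle_permutes[of n] n permutes_compose[OF I_perm t12]
    by (auto simp: P_def A_def B_def sym_group_carrier)
  have H: "subgroup H P"
    unfolding H_def using AB by (rule P.generate_is_subgroup)
  note H' = H[unfolded P_def]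
  have A_mem: "A \<in> H" and B_mem: "B \<in> H"
    by (auto simp: H_def intro: generate.incl)
  interpret G: group G
    unfolding G_def using H by (rule P.subgroup_imp_group)
  have finG: "finite (carrier G)"
    using finP subgroup.subset[OF H] by (simp add: G_def finite_subset)
  have gen: "generates G {A, B}"
    using A_mem B_mem P.generate_consistent[OF _ H, of "{A, B}"]
    by (simp add: generates_def G_def H_def)

  \<comment> \<open>Since \<open>p\<close> fixes 1 and 2 it commutes with \<open>(1 2)\<close>; in
    the cube, \<open>p\<close> vanishes and the involution survives.\<close>
  have cube: "Transposition.transpose 1 2 \<circ> p \<circ> (Transposition.transpose 1 2 \<circ> p) \<circ> (Transposition.transpose 1 2 \<circ> p)
      = Transposition.transpose 1 2" if p: "p \<in> I" for p
  proof -
    have "inv' p 1 = 1" "inv' p 2 = 2"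
      using I_fix[OF p] by (simp_all add: permutes_inv_eq[OF I_perm[OF p]])
    then have comm: "Transposition.transpose 1 2 \<circ> p = p \<circ> Transposition.transpose 1 2"
      using transpose_comp_eq[OF permutes_bij[OF I_perm[OF p]], of 1 2] by simp
    have "Transposition.transpose 1 2 \<circ> p \<circ> (Transposition.transpose 1 2 \<circ> p) \<circ> (Transposition.transpose 1 2 \<circ> p)
        = (p \<circ> (Transposition.transpose 1 2 \<circ> Transposition.transpose 1 2)) \<circ> p \<circ> (p \<circ> Transposition.transpose 1 2)"
      unfolding comm by (simp only: comp_assoc comm)
    also have "\<dots> = (p \<circ> p \<circ> p) \<circ> Transposition.transpose 1 2"
      by (simp add: comp_assoc)
    finally show ?thesis
      using p by (simp add: I_def)
  qed
  have "(\<lambda>p\<in>I. Transposition.transpose 1 2) \<in> H"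
    using subgroup_product_mult[OF T H' subgroup_product_mult[OF T H' B_mem B_mem] B_mem] cube
    by (simp add: B_def sym_group_mult cong: restrict_cong)
  then have "{a \<in> carrier (sym_group n). (\<lambda>i\<in>I. a) \<in> H} = carrier (sym_group n)"
    using A_mem n star_cycle_permutes[of n] t12
    by (intro sym_group_generated_by_star subgroup_diagonal T H') (auto simp: A_def sym_group_carrier)
  then have diag: "(\<lambda>i\<in>I. a) \<in> H" if "a permutes {1..n}" for a
    using that by (auto simp: sym_group_carrier set_eq_iff)

  let ?w = "\<lambda>p\<in>I. p"
  \<comment> \<open>Multiplying \<open>B\<close> by the constant tuple on \<open>(1 2)\<close>
    leaves \<open>?w\<close>, whose entry at \<open>p\<close> is \<open>p\<close> itself; its
    entries are therefore distinct, and they fix 1 and 2.\<close>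
  have "(\<lambda>p\<in>I. Transposition.transpose 1 2 \<circ> (Transposition.transpose 1 2 \<circ> p)) \<in> H"
    using subgroup_product_mult[OF T H' diag[OF t12] B_mem]
    by (simp add: B_def sym_group_mult cong: restrict_cong)
  then have w: "?w \<in> H"
    by (simp add: comp_assoc[symmetric])
  have single: "(\<lambda>j\<in>I. if j = i then a else id) \<in> H"
    if "i \<in> I" "a \<in> carrier (alt_group n)" for i a
    using that w I_fix by (intro single_coordinate_even[OF finI H' diag, where w = ?w]) (auto simp: inj_on_def)

  have "r \<le> card S" if S: "finite S" "invariably_generates G S" for S
  proof (rule ccontr)
    assume "\<not> r \<le> card S"
    then have cS: "card S \<le> r" by simp
    obtain c :: "(nat \<Rightarrow> nat) \<Rightarrow> nat set \<times> bool" where c: "range c \<subseteq> Pow {1..n} \<times> UNIV"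
      "\<And>p q. p permutes {1..n} \<Longrightarrow> q permutes {1..n} \<Longrightarrow> c p = c q \<Longrightarrow>
        \<exists>u. u permutes {1..n} \<and> evenperm u \<and> q = u \<circ> p \<circ> inv' u"
      using ex_alt_class_colouring[of n] by blast
    have "card I \<le> card (Pow {1..n} \<times> (UNIV :: bool set)) ^ card S"
    proof (rule card_le_of_invariably_generates[OF T H', where N = "carrier (alt_group n)" and c = c])
      show "(\<lambda>j\<in>I. if j = i then a else \<one>\<^bsub>sym_group n\<^esub>) \<in> H"
        if "i \<in> I" "a \<in> carrier (alt_group n)" for i a
        unfolding sym_group_one using that by (rule single)
      show "\<exists>u\<in>carrier (alt_group n). q = u \<otimes>\<^bsub>sym_group n\<^esub> p \<otimes>\<^bsub>sym_group n\<^esub> inv\<^bsub>sym_group n\<^esub> u"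
        if "p \<in> carrier (sym_group n)" "q \<in> carrier (sym_group n)" "c p = c q" for p q
        using c(2)[of p q] that by (auto simp: sym_group_carrier alt_group_carrier sym_group_mult)
      show "carrier (alt_group n) \<subseteq> carrier (sym_group n)"
        by (auto simp: alt_group_carrier sym_group_carrier)
      \<comment> \<open>The tuple \<open>?w\<close> separates any two coordinates.\<close>
      show "i = j" if "i \<in> I" "j \<in> I" "\<And>h. h \<in> H \<Longrightarrow> h i = h j" for i j
        using that(3)[OF w] that(1,2) by simp
    qed (use c(1) S in \<open>auto simp: G_def P_def\<close>)
    also have "card (Pow {1..n} \<times> (UNIV :: bool set)) = 2 ^ Suc n"
      by (simp add: card_cartesian_product card_Pow)
    also have "((2::nat) ^ Suc n) ^ card S \<le> (2 ^ Suc n) ^ r"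
      using cS by (rule power_increasing) simp
    also have "\<dots> = (2 ^ (3 * r)) ^ Suc m"
      by (simp only: power_mult[symmetric] n_def) (simp add: algebra_simps)
    finally show False
      using m(2) fact_le_card_order_3[of m] by (simp add: I_def n_def)
  qed
  then have inv_gen: "r \<le> min_inv_gen G"
    using finG by (intro G.min_inv_gen_ge)

  have "min_gen G = 2"
  proof (rule G.min_gen_eq_2[OF gen])
    \<comment> \<open>The constant tuples on \<open>(1 2)\<close> and \<open>(1 3)\<close> do not
      commute, so one generator cannot suffice.\<close>
    let ?a = "Transposition.transpose 1 2 :: nat \<Rightarrow> nat" and ?b = "Transposition.transpose 1 3 :: nat \<Rightarrow> nat"
    have "?b permutes {1..n}"
      using n by (intro permutes_swap_id) auto
    then show "(\<lambda>i\<in>I. ?a) \<in> carrier G" "(\<lambda>i\<in>I. ?b) \<in> carrier G"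
      using diag t12 by (simp_all add: G_def)
    have "(?a \<circ> ?b) 1 \<noteq> (?b \<circ> ?a) 1"
      by simp
    then have "?a \<circ> ?b \<noteq> ?b \<circ> ?a"
      by metis
    then show "(\<lambda>i\<in>I. ?a) \<otimes>\<^bsub>G\<^esub> (\<lambda>i\<in>I. ?b) \<noteq> (\<lambda>i\<in>I. ?b) \<otimes>\<^bsub>G\<^esub> (\<lambda>i\<in>I. ?a)"
      using \<open>id \<in> I\<close> by (auto simp: G_def P_def sym_group_mult dest!: fun_cong[where x = id])
  qed
  moreover obtain K :: "nat monoid" where K: "group K" "G \<cong> K"
    using G.ex_nat_monoid_iso[OF finG] by blast
  moreover have "finite (carrier K)"
    using K(2) finG by (auto simp: is_iso_def iso_def bij_betw_finite)
  ultimately show ?thesis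
    using is_iso_min_gen_eq[OF G.is_group K] inv_gen by metis
qed

end
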